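(* There is an infinite family $\mathcal{H}$ of graphs such that the following holds for every $H \in \mathcal{H}$. There exists a constant $c_H>0$ such that for every fixed $\varepsilon>0$ and every $p=p(n)\in[0,1]$ with $n^{-1/m_H} \ll p \ll n^{-1/m_H}(\log n)^{c_H}$ we have, as $n\to\infty$, $$-\log \mathbb{P}\bigl(X_H \ge (1+\varepsilon)\,\mathbb{E} X_H\bigr) = o\Bigl(\min\bigl\{\Phi_H,\; M_H\log(1/p)\bigr\}\Bigr).$$
   Context: All graphs are finite and simple; $v_G$, $e_G$, $\Delta_G$ denote the number of vertices, the number of edges and the maximum degree of $G$. $G_{n,p}$ is the binomial random graph on vertex set $[n]=\{1,\dots,n\}$ (each of the $\binom n2$ edges is present independently with probability $p$). For a fixed graph $H$ with $e_H\ge 1$, $X_H=X_H(n,p)$ is the number of copies of $H$ in $G_{n,p}$, i.e. of (not necessarily induced) subgraphs of $G_{n,p}$ isomorphic to $H$, and $\mu_H=\mathbb{E}X_H$; similarly $\mu_G=\mathbb{E}X_G$ for subgraphs $G\subseteq H$. Set $m_H:=\max_{F\subseteq H:\, v_F\ge 1} e_F/v_F$ and $$\Phi_H=\Phi_H(n,p):=\min_{G\subseteq H:\, e_G\ge 1}\mu_G,\qquad M_H=M_H(n,p):=\begin{cases}\min_{G\subseteq H:\,e_G\ge1}\mu_G^{1/\alpha^*_G} & \text{if } p<n^{-1/\Delta_H},\\ n^2p^{\Delta_H} & \text{if } p\ge n^{-1/\Delta_H},\end{cases}$$ where $\alpha^*_G$ is the fractional independence number of $G$: the maximum of $\sum_{v\in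 V(G)}f(v)$ over all $f:V(G)\to[0,1]$ with $f(u)+f(v)\le 1$ for every edge $\{u,v\}\in E(G)$. Asymptotics are as $n\to\infty$, and $a\ll b$ means $a=o(b)$. *)

theory Defs
  imports "HOL-Probability.Probability" "HOL-Library.Landau_Symbols"
begin

section \<open>Finite simple graphs\<close>

type_synonym 'a sgraph = "'a set \<times> 'a set set"

abbreviation verts :: "'a sgraph \<Rightarrow> 'a set" where
  "verts \<equiv> fst"

abbreviation edges :: "'a sgraph \<Rightarrow> 'a set set" where
  "edges \<equiv> snd"

definition simple_graph :: "'a sgraph \<Rightarrow> bool" where
  "simple_graph G \<longleftrightarrow> finite (verts G) \<and> (\<forall>e\<in>edges G. e \<subseteq> verts G \<and> card e = 2)"

definition subgraphs :: "'a sgraph \<Rightarrow> 'a sgraph set" where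
  "subgraphs H = {G. simple_graph G \<and> verts G \<subseteq> verts H \<and> edges G \<subseteq> edges H}"

definition graph_iso :: "'a sgraph \<Rightarrow> 'b sgraph \<Rightarrow> bool"  (infix "\<simeq>\<^sub>g" 50) where
  "G \<simeq>\<^sub>g H \<longleftrightarrow> (\<exists>f. bij_betw f (verts G) (verts H) \<and> (\<lambda>e. f ` e) ` edges G = edges H)"

definition max_degree :: "'a sgraph \<Rightarrow> nat" where
  "max_degree H = Max ((\<lambda>v. card {e \<in> edges H. v \<in> e}) ` verts H)"

definition max_density :: "'a sgraph \<Rightarrow> real" where
  "max_density H =
     Max ((\<lambda>F. real (card (edges F)) / real (card (verts F))) ` {F \<in> subgraphs H. verts F \<noteq> {}})"

text \<open>The supremum is a maximum: only the values of \<open>f\<close> on the finite vertex set matter, so it is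
  taken over a nonempty compact polytope.\<close>

definition frac_indep_number :: "'a sgraph \<Rightarrow> real" where
  "frac_indep_number G =
     Sup {(\<Sum>v\<in>verts G. f v) | f :: 'a \<Rightarrow> real.
            (\<forall>v\<in>verts G. 0 \<le> f v \<and> f v \<le> 1) \<and>
            (\<forall>u v. {u, v} \<in> edges G \<longrightarrow> f u + f v \<le> 1)}"


section \<open>Subgraph counts in the binomial random graph\<close>

definition gnp :: "nat \<Rightarrow> real \<Rightarrow> nat sgraph pmf" where
  "gnp n p =
     map_pmf (\<lambda>b. ({1..n}, {e. e \<subseteq> {1..n} \<and> card e = 2 \<and> b e}))
       (Pi_pmf {e. e \<subseteq> {1..n} \<and> card e = 2} False (\<lambda>_. bernoulli_pmf p))"

definition copy_count :: "'a sgraph \<Rightarrow> 'b sgraph \<Rightarrow> nat" where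
  "copy_count H G = card {F \<in> subgraphs G. F \<simeq>\<^sub>g H}"

definition mu :: "'a sgraph \<Rightarrow> nat \<Rightarrow> real \<Rightarrow> real" where
  "mu H n p = measure_pmf.expectation (gnp n p) (\<lambda>G. real (copy_count H G))"

definition upper_tail_prob :: "'a sgraph \<Rightarrow> real \<Rightarrow> nat \<Rightarrow> real \<Rightarrow> real" where
  "upper_tail_prob H \<epsilon> n p =
     measure_pmf.prob (gnp n p) {G. real (copy_count H G) \<ge> (1 + \<epsilon>) * mu H n p}"

definition Phi :: "'a sgraph \<Rightarrow> nat \<Rightarrow> real \<Rightarrow> real" where
  "Phi H n p = Min ((\<lambda>G. mu G n p) ` {G \<in> subgraphs H. edges G \<noteq> {}})"

definition M_bound :: "'a sgraph \<Rightarrow> nat \<Rightarrow> real \<Rightarrow> real" where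
  "M_bound H n p =
     (if p < real n powr (- 1 / real (max_degree H))
      then Min ((\<lambda>G. mu G n p powr (1 / frac_indep_number G)) ` {G \<in> subgraphs H. edges G \<noteq> {}})
      else (real n)\<^sup>2 * p ^ max_degree H)"

text \<open>Since \<open>ln 0 = 0\<close> here, an upper bound on \<open>- ln (upper_tail_prob H \<epsilon> n p)\<close> carries its
  mathematical meaning (where \<open>- log 0 = \<infinity>\<close>) only together with \<open>upper_tail_prob H \<epsilon> n p > 0\<close>.\<close>

end

theory Submission
  imports Defs "HOL-Real_Asymp.Real_Asymp"
begin

text \<open>
  The graphs are brooms: a triangle with \<open>k \<ge> 3\<close> pendant edges at one of its vertices. Their maximal
  density is 1; write \<open>p = \<omega>/n\<close> and take \<open>c = 1/3\<close>, so that \<open>\<omega>\<close> tends to infinity and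
  \<open>\<omega>\<^sup>3 \<le> ln n\<close>. Every subgraph of a broom with an edge has expectation of order at least \<open>\<omega>\<^sup>3\<close>
  (attained by the triangle), and \<open>log (1/p)\<close> is of order \<open>log n\<close>; so the minimum in the theorem has
  order at least \<open>\<omega>\<^sup>3\<close>. On the other hand, a triangle is present with probability bounded below
  (second moment method), and a single triangle, one of whose vertices has degree \<open>C\<omega>\<^sup>2\<close>, already
  lies in order \<open>(C\<omega>\<^sup>2)\<^sup>k\<close> brooms, while the expectation is at most \<open>\<omega>\<^bsup>k+3\<^esup>\<close>, so that
  \<open>k \<ge> 3\<close> and a large constant \<open>C\<close> suffice. The large degree costs only \<open>O(\<omega>\<^sup>2 log \<omega>)\<close> in the exponent; it is independent of
  the triangle when the triangle and the pendant vertices come from disjoint parts of the vertex set.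
\<close>

section \<open>Products of Bernoulli variables\<close>

abbreviation bernoulli_product :: "'a set \<Rightarrow> real \<Rightarrow> ('a \<Rightarrow> bool) pmf" where
  "bernoulli_product E p \<equiv> Pi_pmf E False (\<lambda>_. bernoulli_pmf p)"

lemma prob_all_true:
  assumes "finite E" "S \<subseteq> E" "0 \<le> p" "p \<le> 1"
  shows "measure_pmf.prob (bernoulli_product E p) {b. \<forall>e\<in>S. b e} = p ^ card S"
proof -
  have eq: "{b. \<forall>e\<in>S. b e} = Pi E (\<lambda>e. if e \<in> S then {True} else UNIV)"
    using assms(2) by (auto simp: Pi_def split: if_splits)
  have "measure_pmf.prob (bernoulli_product E p) {b. \<forall>e\<in>S. b e}
      = (\<Prod>e\<in>E. measure_pmf.prob (bernoulli_pmf p) (if e \<in> S then {True} else UNIV))"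
    unfolding eq using assms(1) by (rule measure_Pi_pmf_Pi)
  also have "\<dots> = (\<Prod>e\<in>E. if e \<in> S then p else 1)"
    using assms(3,4) by (intro prod.cong) (auto simp: measure_pmf_single)
  also have "\<dots> = (\<Prod>e\<in>E \<inter> S. p)"
    by (rule prod.inter_restrict[OF assms(1), symmetric])
  finally show ?thesis
    using assms(2) by (simp add: inf.absorb2)
qed

text \<open>A single binomial point mass already bounds the tail from below; nothing more is lost
  than the exponent can afford.\<close>

lemma prob_count_ge:
  assumes "finite E" "S \<subseteq> E" "0 \<le> p" "p \<le> 1"
  shows "real (card S choose d) * p ^ d * (1 - p) ^ (card S - d)
    \<le> measure_pmf.prob (bernoulli_product E p) {b. d \<le> card {e \<in> S. b e}}"
proof -
  have "finite S"
    using assms(1,2) by (rule rev_finite_subset)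
  have "real (card S choose d) * p ^ d * (1 - p) ^ (card S - d) = pmf (binomial_pmf (card S) p) d"
    using assms(3,4) by simp
  also have "binomial_pmf (card S) p
      = map_pmf (\<lambda>f. card {x \<in> S. f x}) (bernoulli_product S p)"
    using \<open>finite S\<close> assms(3,4) by (intro binomial_pmf_altdef') auto
  \<comment> \<open>The product over \<open>S\<close> is the marginal of the product over
    \<open>E\<close>, and the count inspects only coordinates in \<open>S\<close>.\<close>
  also have "\<dots> = map_pmf (\<lambda>f. card {x \<in> S. f x}) (bernoulli_product E p)"
    unfolding Pi_pmf_subset[OF assms(1,2)] map_pmf_comp
    by (intro map_pmf_cong refl arg_cong[of _ _ card]) auto
  also have "pmf \<dots> d = measure_pmf.prob (bernoulli_product E p) {b. card {e \<in> S. b e} = d}"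
    by (simp add: pmf_map vimage_def)
  also have "\<dots> \<le> measure_pmf.prob (bernoulli_product E p) {b. d \<le> card {e \<in> S. b e}}"
    by (intro measure_pmf.finite_measure_mono) auto
  finally show ?thesis .
qed

text \<open>Expose the coordinates in \<open>A\<close> first, then those in \<open>B\<close>. The
  second event may depend on the first outcome \<open>f\<close> (later: a star centred at a vertex
  of the triangle just found), as long as \<open>q\<close> bounds its probability uniformly over all
  good \<open>f\<close>.\<close>

lemma prob_two_stage:
  assumes "finite A" "finite B" "A \<inter> B = {}" "0 \<le> q"
    and stage2: "\<And>f. P f \<Longrightarrow> q \<le> measure_pmf.prob (Pi_pmf B dflt M) {g. Q f g}"
    and merge: "\<And>f g. P f \<Longrightarrow> Q f g \<Longrightarrow> (\<lambda>x. if x \<in> A then f x else g x) \<in> X"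
  shows "measure_pmf.prob (Pi_pmf A dflt M) {f. P f} * q \<le> measure_pmf.prob (Pi_pmf (A \<union> B) dflt M) X"
proof -
  let ?MA = "Pi_pmf A dflt M" and ?MB = "Pi_pmf B dflt M"
  let ?h = "\<lambda>f g x. if x \<in> A then f x else g x"
  have union: "Pi_pmf (A \<union> B) dflt M = bind_pmf ?MA (\<lambda>f. map_pmf (?h f) ?MB)"
    unfolding Pi_pmf_union[OF assms(1-3)] pair_pmf_def
    by (simp add: map_pmf_def bind_assoc_pmf bind_return_pmf)
  have "ennreal (measure_pmf.prob ?MA {f. P f} * q) = (\<integral>\<^sup>+f. ennreal q * indicator {f. P f} f \<partial>?MA)"
    using assms(4) by (simp add: nn_integral_cmult_indicator measure_pmf.emeasure_eq_measure
        ennreal_mult mult.commute)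
  also have "\<dots> \<le> (\<integral>\<^sup>+f. emeasure (map_pmf (?h f) ?MB) X \<partial>?MA)"
  proof (intro nn_integral_mono)
    fix f
    show "ennreal q * indicator {f. P f} f \<le> emeasure (map_pmf (?h f) ?MB) X"
    proof (cases "P f")
      case True
      have "q \<le> measure_pmf.prob ?MB {g. Q f g}"
        using True by (rule stage2)
      also have "\<dots> \<le> measure_pmf.prob ?MB (?h f -` X)"
        using merge[OF True] by (intro measure_pmf.finite_measure_mono) auto
      finally show ?thesis
        using True by (simp add: measure_pmf.emeasure_eq_measure)
    qed simp
  qed
  also have "\<dots> = emeasure (Pi_pmf (A \<union> B) dflt M) X"
    by (simp add: union)
  finally show ?thesis
    by (simp add: measure_pmf.emeasure_eq_measure)
qed

text \<open>With \<open>X\<close> the number of events that occur, 2tX - (tX)^2 = 1 - (1 - tX)^2 is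
  at most 1, and it vanishes for X = 0. So its expectation is a lower bound for the probability that
  some event occurs. The value t = 1/(Kx) maximises the resulting bound 2tx - K(tx)^2.\<close>

lemma second_moment_prob:
  fixes M :: "'b pmf" and ev :: "'i \<Rightarrow> 'b \<Rightarrow> bool"
  assumes fin: "finite I"
    and lower: "(\<Sum>i\<in>I. measure_pmf.prob M {b. ev i b}) = x" "0 < x"
    and upper: "(\<Sum>i\<in>I. \<Sum>j\<in>I. measure_pmf.prob M {b. ev i b \<and> ev j b}) \<le> K * x\<^sup>2" "0 < K"
  shows "1 / K \<le> measure_pmf.prob M {b. \<exists>i\<in>I. ev i b}"
proof -
  define t where "t = 1 / (K * x)"
  define X where "X b = (\<Sum>i\<in>I. indicator {b. ev i b} b :: real)" for b
  have int: "integrable M (indicator A :: 'b \<Rightarrow> real)" for A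
    by (simp add: measure_pmf.emeasure_eq_measure)
  have X2: "(X b)\<^sup>2 = (\<Sum>i\<in>I. \<Sum>j\<in>I. indicator {b. ev i b \<and> ev j b} b)" for b
    unfolding X_def power2_eq_square sum_product
    by (intro sum.cong refl) (auto simp: indicator_def)
  have EX: "measure_pmf.expectation M X = x"
    unfolding X_def using lower(1) int by (simp add: Bochner_Integration.integral_sum)
  have intX: "integrable M X"
    unfolding X_def using int by (intro Bochner_Integration.integrable_sum)
  have intX2: "integrable M (\<lambda>b. (X b)\<^sup>2)"
    unfolding X2 using int by (intro Bochner_Integration.integrable_sum)
  have EX2: "measure_pmf.expectation M (\<lambda>b. (X b)\<^sup>2) \<le> K * x\<^sup>2"
    unfolding X2 using upper(1) int by (simp add: Bochner_Integration.integral_sum)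
  have "1 / K = 2 * t * x - t\<^sup>2 * (K * x\<^sup>2)"
    using lower(2) upper(2) by (simp add: t_def field_simps power2_eq_square)
  also have "\<dots> \<le> 2 * t * measure_pmf.expectation M X - t\<^sup>2 * measure_pmf.expectation M (\<lambda>b. (X b)\<^sup>2)"
    using EX EX2 by (simp add: mult_left_mono)
  also have "\<dots> = measure_pmf.expectation M (\<lambda>b. 2 * t * X b - t\<^sup>2 * (X b)\<^sup>2)"
    using intX intX2 by simp
  also have "\<dots> \<le> measure_pmf.expectation M (indicator {b. \<exists>i\<in>I. ev i b})"
  proof (intro integral_mono)
    fix b
    show "2 * t * X b - t\<^sup>2 * (X b)\<^sup>2 \<le> indicator {b. \<exists>i\<in>I. ev i b} b"
    proof (cases "\<exists>i\<in>I. ev i b")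
      case True
      have "2 * t * X b - t\<^sup>2 * (X b)\<^sup>2 = 1 - (1 - t * X b)\<^sup>2"
        by (simp add: power2_eq_square algebra_simps)
      then show ?thesis
        using True by simp
    next
      case False
      then have "X b = 0"
        unfolding X_def by (intro sum.neutral) (auto simp: indicator_def)
      then show ?thesis
        by simp
    qed
  qed (use intX intX2 int in auto)
  also have "\<dots> = measure_pmf.prob M {b. \<exists>i\<in>I. ev i b}"
    by simp
  finally show ?thesis .
qed

section \<open>Copies of a graph\<close>

text \<open>The inverse bijection undoes \<open>f\<close> only on subsets of the vertex set, so the
  edges of \<open>F\<close> have to lie there; this is what simplicity provides.\<close>

lemma graph_iso_sym:
  assumes "simple_graph F" "F \<simeq>\<^sub>g G"
  shows "G \<simeq>\<^sub>g F"
proof -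
  obtain f where f: "bij_betw f (verts F) (verts G)" "(\<lambda>e. f ` e) ` edges F = edges G"
    using assms(2) unfolding graph_iso_def by blast
  let ?g = "inv_into (verts F) f"
  have "?g ` f ` e = e" if "e \<in> edges F" for e
    using that assms(1) f(1)
    by (intro inv_into_image_cancel) (auto simp: simple_graph_def bij_betw_def)
  then have "(\<lambda>e. ?g ` e) ` edges G = edges F"
    unfolding f(2)[symmetric] image_image by simp
  then show ?thesis
    using bij_betw_inv_into[OF f(1)] unfolding graph_iso_def by blast
qed

lemma graph_iso_card_verts: "F \<simeq>\<^sub>g G \<Longrightarrow> card (verts F) = card (verts G)"
  unfolding graph_iso_def by (auto dest: bij_betw_same_card)

lemma graph_iso_card_edges:
  assumes "simple_graph F" "F \<simeq>\<^sub>g G"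
  shows "card (edges F) = card (edges G)"
proof -
  obtain f where f: "bij_betw f (verts F) (verts G)" "(\<lambda>e. f ` e) ` edges F = edges G"
    using assms(2) unfolding graph_iso_def by blast
  have "inj_on (\<lambda>e. f ` e) (edges F)"
    using assms(1) f(1)
    by (intro inj_on_subset[OF inj_on_image_Pow]) (auto simp: bij_betw_def simple_graph_def)
  then show ?thesis
    unfolding f(2)[symmetric] by (simp add: card_image)
qed

lemma simple_graph_image:
  assumes "simple_graph G" "inj_on f (verts G)"
  shows "simple_graph (f ` verts G, (\<lambda>e. f ` e) ` edges G)"
proof -
  have "card (f ` e) = card e" if "e \<in> edges G" for e
    using that assms by (intro card_image) (auto simp: simple_graph_def intro: inj_on_subset)
  then show ?thesis
    using assms(1) by (auto simp: simple_graph_def)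
qed

lemma finite_subgraphs: "finite (verts G) \<Longrightarrow> finite (subgraphs G)"
  by (rule finite_subset[of _ "Pow (verts G) \<times> Pow (Pow (verts G))"])
    (auto simp: subgraphs_def simple_graph_def, blast)

section \<open>Copies in the complete graph and the first moment\<close>

abbreviation vertex_pairs :: "nat \<Rightarrow> nat set set" where
  "vertex_pairs n \<equiv> {e. e \<subseteq> {1..n} \<and> card e = 2}"

lemma finite_vertex_pairs: "finite (vertex_pairs n)"
  by simp

text \<open>A deterministic index set: the copy count of the random graph is the number of these
  potential copies all of whose edges are present, hence a sum of indicators.\<close>

definition copies :: "'a sgraph \<Rightarrow> nat \<Rightarrow> nat sgraph set" where
  "copies G n = {F \<in> subgraphs ({1..n}, vertex_pairs n). F \<simeq>\<^sub>g G}"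

lemma finite_copies: "finite (copies G n)"
  unfolding copies_def using finite_subgraphs[of "({1..n}, vertex_pairs n)"] by simp

lemma mu_eq_card_copies:
  fixes p :: real
  assumes "0 \<le> p" "p \<le> 1"
  shows "mu G n p = real (card (copies G n)) * p ^ card (edges G)"
proof -
  let ?E = "vertex_pairs n"
  let ?M = "bernoulli_product ?E p"
  have int: "integrable ?M (indicator A :: _ \<Rightarrow> real)" for A
    by (simp add: measure_pmf.emeasure_eq_measure)
  have "{F \<in> subgraphs ({1..n}, {e. e \<subseteq> {1..n} \<and> card e = 2 \<and> b e}). F \<simeq>\<^sub>g G}
      = {F \<in> copies G n. \<forall>e\<in>edges F. b e}" for b
    by (auto simp: copies_def subgraphs_def)
  then have count: "real (copy_count G ({1..n}, {e. e \<subseteq> {1..n} \<and> card e = 2 \<and> b e}))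
      = (\<Sum>F\<in>copies G n. indicator {b. \<forall>e\<in>edges F. b e} b)" for b
    unfolding copy_count_def
    by (simp add: indicator_def sum.If_cases[OF finite_copies] Int_def of_bool_def)
  have prob: "measure_pmf.prob ?M {b. \<forall>e\<in>edges F. b e} = p ^ card (edges G)"
    if "F \<in> copies G n" for F
  proof -
    have F: "simple_graph F" "F \<simeq>\<^sub>g G" "edges F \<subseteq> ?E"
      using that by (auto simp: copies_def subgraphs_def)
    show ?thesis
      using prob_all_true[OF finite_vertex_pairs F(3) assms] graph_iso_card_edges[OF F(1,2)] by simp
  qed
  have "mu G n p = measure_pmf.expectation ?M (\<lambda>b. \<Sum>F\<in>copies G n. indicator {b. \<forall>e\<in>edges F. b e} b)"
    unfolding mu_def gnp_def integral_map_pmf count ..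
  also have "\<dots> = (\<Sum>F\<in>copies G n. measure_pmf.prob ?M {b. \<forall>e\<in>edges F. b e})"
    using int by (simp add: Bochner_Integration.integral_sum)
  also have "\<dots> = (\<Sum>F\<in>copies G n. p ^ card (edges G))"
    by (intro sum.cong prob refl)
  finally show ?thesis
    by simp
qed

text \<open>Every vertex set of the right size carries a copy, obtained by transporting
  \<open>G\<close> along a bijection, and different vertex sets carry different copies.\<close>

lemma binomial_le_card_copies:
  assumes "simple_graph G"
  shows "n choose card (verts G) \<le> card (copies G n)"
proof -
  have "{S. S \<subseteq> {1..n} \<and> card S = card (verts G)} \<subseteq> verts ` copies G n"
  proof
    fix S assume "S \<in> {S. S \<subseteq> {1..n} \<and> card S = card (verts G)}"
    then have S: "S \<subseteq> {1..n}" "card S = card (verts G)"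
      by auto
    have "finite S"
      using S(1) finite_subset by blast
    then obtain f where f: "bij_betw f (verts G) S"
      using S(2) assms finite_same_card_bij[of "verts G" S] by (auto simp: simple_graph_def)
    let ?F = "(f ` verts G, (\<lambda>e. f ` e) ` edges G)"
    have img: "f ` verts G = S" and inj: "inj_on f (verts G)"
      using f by (auto simp: bij_betw_def)
    have simple: "simple_graph ?F"
      using assms inj by (rule simple_graph_image)
    have "G \<simeq>\<^sub>g ?F"
      unfolding graph_iso_def using f img by auto
    then have "?F \<simeq>\<^sub>g G"
      using assms by (rule graph_iso_sym[rotated])
    moreover have "edges ?F \<subseteq> vertex_pairs n"
    proof
      fix e assume "e \<in> edges ?F"
      then have "e \<subseteq> S" "card e = 2"
        using simple img by (auto simp only: simple_graph_def fst_conv snd_conv)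
      then show "e \<in> vertex_pairs n"
        using S(1) by blast
    qed
    then have "?F \<in> subgraphs ({1..n}, vertex_pairs n)"
      using simple S(1) img by (simp add: subgraphs_def)
    ultimately have "?F \<in> copies G n"
      unfolding copies_def by simp
    then show "S \<in> verts ` copies G n"
      using image_eqI[of S verts ?F] img by simp
  qed
  then have "card {S. S \<subseteq> {1..n} \<and> card S = card (verts G)} \<le> card (verts ` copies G n)"
    by (intro card_mono finite_imageI finite_copies)
  also have "\<dots> \<le> card (copies G n)"
    using finite_copies by (rule card_image_le)
  finally show ?thesis
    by (simp add: n_subsets)
qed

text \<open>A copy is the image of \<open>G\<close> under some map from its vertices to
  \<open>{1..n}\<close>. Restricting the map to \<open>verts G\<close> puts it into a finite
  function space and leaves the image unchanged.\<close>

lemma card_copies_le: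
  assumes "simple_graph G"
  shows "card (copies G n) \<le> n ^ card (verts G)"
proof -
  have fin: "finite (verts G)"
    using assms by (simp add: simple_graph_def)
  have "copies G n \<subseteq> (\<lambda>f. (f ` verts G, (\<lambda>e. f ` e) ` edges G)) ` (verts G \<rightarrow>\<^sub>E {1..n})"
  proof
    fix F assume "F \<in> copies G n"
    then have F: "simple_graph F" "F \<simeq>\<^sub>g G" "verts F \<subseteq> {1..n}"
      by (auto simp: copies_def subgraphs_def)
    obtain f where f: "bij_betw f (verts G) (verts F)" "(\<lambda>e. f ` e) ` edges G = edges F"
      using graph_iso_sym[OF F(1,2)] unfolding graph_iso_def by blast
    let ?f = "restrict f (verts G)"
    have "?f ` e = f ` e" if "e \<in> edges G" for e
      using that assms by (intro image_cong) (auto simp: simple_graph_def)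
    then have "(\<lambda>e. ?f ` e) ` edges G = edges F"
      using f(2) by (metis (mono_tags, lifting) image_cong)
    moreover have "?f ` verts G = verts F"
      using f(1) by (auto simp: bij_betw_def)
    moreover have "?f \<in> verts G \<rightarrow>\<^sub>E {1..n}"
      using f(1) F(3) by (auto simp: bij_betw_def)
    ultimately show "F \<in> (\<lambda>f. (f ` verts G, (\<lambda>e. f ` e) ` edges G)) ` (verts G \<rightarrow>\<^sub>E {1..n})"
      by (intro image_eqI[of _ _ ?f]) (simp_all add: prod_eq_iff)
  qed
  then have "card (copies G n) \<le> card (verts G \<rightarrow>\<^sub>E {1..n})"
    by (meson card_image_le card_mono fin finite_PiE finite_atLeastAtMost finite_imageI le_trans)
  also have "\<dots> = n ^ card (verts G)"
    using fin by (simp add: card_PiE)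
  finally show ?thesis .
qed

section \<open>Triangles\<close>

definition triangle :: "'a \<Rightarrow> 'a \<Rightarrow> 'a \<Rightarrow> 'a set set" where
  "triangle a b c = {{a, b}, {a, c}, {b, c}}"

text \<open>The disequalities hold when the two triangles take their first, second and third
  vertices from three disjoint classes. Then only vertices in the same position can coincide, and an
  edge is shared exactly when two positions agree.\<close>

lemma card_two_triangles:
  assumes "a \<noteq> b" "a \<noteq> c" "b \<noteq> c" "x \<noteq> y" "x \<noteq> z" "y \<noteq> z"
    "a \<noteq> y" "a \<noteq> z" "b \<noteq> x" "b \<noteq> z" "c \<noteq> x" "c \<noteq> y"
  shows "card (triangle a b c \<union> triangle x y z) =
    (if x = a \<and> y = b \<and> z = c then 3
     else if x = a \<and> y = b \<or> x = a \<and> z = c \<or> y = b \<and> z = c then 5 else 6)"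
proof -
  note card = triangle_def Un_insert_left Un_empty_left card_insert_if finite_insert finite.emptyI
    card.empty insert_iff empty_iff doubleton_eq_iff simp_thms if_True if_False assms assms[symmetric]
  have "card (triangle a b c \<union> triangle a b c) = 3"
    by (simp only: card)
  moreover have "card (triangle a b c \<union> triangle a b z) = 5" if "z \<noteq> c"
    by (simp only: card that that[symmetric])
  moreover have "card (triangle a b c \<union> triangle a y c) = 5" if "y \<noteq> b"
    by (simp only: card that that[symmetric])
  moreover have "card (triangle a b c \<union> triangle x b c) = 5" if "x \<noteq> a"
    by (simp only: card that that[symmetric])
  moreover have "card (triangle a b c \<union> triangle x y z) = 6" if "x \<noteq> a" "y \<noteq> b"
    by (simp only: card that that[symmetric])
  moreover have "card (triangle a b c \<union> triangle x y z) = 6" if "x \<noteq> a" "z \<noteq> c"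
    by (simp only: card that that[symmetric])
  moreover have "card (triangle a b c \<union> triangle x y z) = 6" if "y \<noteq> b" "z \<noteq> c"
    by (simp only: card that that[symmetric])
  ultimately show ?thesis
    by (cases "x = a"; cases "y = b"; cases "z = c") simp_all
qed

text \<open>The case distinction becomes a sum of nonnegative terms, one for each way to overlap, so
  that a sum over all triangles splits into five easy sums.\<close>

lemma power_card_two_triangles_le:
  fixes p :: real
  assumes "0 \<le> p" "a \<noteq> b" "a \<noteq> c" "b \<noteq> c" "x \<noteq> y" "x \<noteq> z" "y \<noteq> z"
    "a \<noteq> y" "a \<noteq> z" "b \<noteq> x" "b \<noteq> z" "c \<noteq> x" "c \<noteq> y"
  shows "p ^ card (triangle a b c \<union> triangle x y z)
    \<le> p ^ 6 + (if x = a \<and> y = b then p ^ 5 else 0) + (if x = a \<and> z = c then p ^ 5 else 0)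
      + (if y = b \<and> z = c then p ^ 5 else 0) + (if x = a \<and> y = b \<and> z = c then p ^ 3 else 0)"
  unfolding card_two_triangles[OF assms(2-)]
  by (cases "x = a"; cases "y = b"; cases "z = c") (simp_all add: assms(1))

text \<open>Second moment method for the triangles with one vertex in each third of
  \<open>{1..3 * m}\<close>. The partition indexes each of them by exactly one triple and limits the
  ways in which two of them overlap.\<close>

lemma prob_triangle_ge:
  fixes p :: real
  assumes "1 \<le> m" "1 \<le> real m * p" "p \<le> 1"
  shows "1 / 5 \<le> measure_pmf.prob (bernoulli_product (vertex_pairs (3 * m)) p)
    {b. \<exists>x y z. {x, y, z} \<subseteq> {1..3 * m} \<and> distinct [x, y, z] \<and> (\<forall>e\<in>triangle x y z. b e)}"
proof -
  define A B C where "A = {1..m}" and "B = {m + 1..2 * m}" and "C = {2 * m + 1..3 * m}"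
  let ?E = "vertex_pairs (3 * m)"
  let ?M = "bernoulli_product ?E p"
  let ?I = "A \<times> B \<times> C"
  let ?tri = "\<lambda>(a, b, c). triangle a b c"
  let ?ev = "\<lambda>i b. \<forall>e\<in>?tri i. b e"
  let ?x = "(real m * p) ^ 3"
  have p: "0 \<le> p"
  proof (rule ccontr)
    assume "\<not> 0 \<le> p"
    then have "real m * p \<le> 0"
      by (simp add: mult_nonneg_nonpos)
    then show False
      using assms(2) by simp
  qed
  have fin: "finite A" "finite B" "finite C" and card: "card A = m" "card B = m" "card C = m"
    by (auto simp: A_def B_def C_def)
  have ordered: "a < b" "b < c" "a < c" "a \<noteq> b" "b \<noteq> c" "a \<noteq> c" "b \<noteq> a" "c \<noteq> b" "c \<noteq> a"
      "{a, b, c} \<subseteq> {1..3 * m}"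
    if "a \<in> A" "b \<in> B" "c \<in> C" for a b c
    using that by (auto simp: A_def B_def C_def)
  have sub: "?tri i \<subseteq> ?E" if "i \<in> ?I" for i
    using that ordered by (auto simp: triangle_def split: prod.splits)
  have prob1: "measure_pmf.prob ?M {b. ?ev i b} = p ^ 3" if i: "i \<in> ?I" for i
  proof -
    have "card (?tri i) = 3"
      using i ordered by (auto simp: triangle_def doubleton_eq_iff card_insert_if)
    then show ?thesis
      using prob_all_true[OF finite_vertex_pairs sub[OF i] p assms(3)] by simp
  qed
  have prob2: "measure_pmf.prob ?M {b. ?ev (a, b', c) b \<and> ?ev (x, y, z) b}
      \<le> p ^ 6 + (if x = a \<and> y = b' then p ^ 5 else 0) + (if x = a \<and> z = c then p ^ 5 else 0)
        + (if y = b' \<and> z = c then p ^ 5 else 0) + (if x = a \<and> y = b' \<and> z = c then p ^ 3 else 0)"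
    (is "_ \<le> ?bound a b' c x y z")
    if i: "a \<in> A" "b' \<in> B" "c \<in> C" "x \<in> A" "y \<in> B" "z \<in> C" for a b' c x y z
  proof -
    let ?S = "triangle a b' c \<union> triangle x y z"
    have "?S \<subseteq> ?E"
      using sub[of "(a, b', c)"] sub[of "(x, y, z)"] i by auto
    then have "measure_pmf.prob ?M {b. \<forall>e\<in>?S. b e} = p ^ card ?S"
      by (rule prob_all_true[OF finite_vertex_pairs _ p assms(3)])
    also have "\<dots> \<le> ?bound a b' c x y z"
      \<comment> \<open>The mixed triples \<open>(a, y, z)\<close>, \<open>(x, b', z)\<close> and
        \<open>(x, y, c)\<close> also have one vertex in each class, which yields the disequalities
        between the two triangles.\<close>
      using ordered(4-9)[OF i(1-3)] ordered(4-9)[OF i(4-6)] ordered(4-9)[OF i(1,5,6)]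
        ordered(4-9)[OF i(4,2,6)] ordered(4-9)[OF i(4,5,3)]
      by (intro power_card_two_triangles_le p)
    finally show ?thesis
      by (simp add: ball_Un)
  qed
  have row: "(\<Sum>j\<in>?I. measure_pmf.prob ?M {b. ?ev i b \<and> ?ev j b})
      \<le> real m ^ 3 * p ^ 6 + 3 * real m * p ^ 5 + p ^ 3" if iI: "i \<in> ?I" for i
  proof -
    obtain a b c where i: "i = (a, b, c)" "a \<in> A" "b \<in> B" "c \<in> C"
      using iI by auto
    have "(\<Sum>j\<in>?I. measure_pmf.prob ?M {b. ?ev i b \<and> ?ev j b})
        \<le> (\<Sum>j\<in>?I. case j of (x, y, z) \<Rightarrow> ?bound a b c x y z)"
    proof (intro sum_mono)
      fix j assume "j \<in> ?I"
      then show "measure_pmf.prob ?M {b. ?ev i b \<and> ?ev j b} \<le> (case j of (x, y, z) \<Rightarrow> ?bound a b c x y z)"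
        using prob2[OF i(2-4), of "fst j" "fst (snd j)" "snd (snd j)"] i(1) by auto
    qed
    also have "\<dots> = (\<Sum>x\<in>A. \<Sum>y\<in>B. \<Sum>z\<in>C. ?bound a b c x y z)"
      by (simp add: sum.cartesian_product)
    also have "\<dots> = real m ^ 3 * p ^ 6 + 3 * real m * p ^ 5 + p ^ 3"
    proof -
      \<comment> \<open>Each condition is moved outwards to the sum over its own variable, where the
        sum collapses to one term. Each p^5 sum then has one free variable left and contributes m
        p^5.\<close>
      have "(\<Sum>x\<in>A. \<Sum>y\<in>B. \<Sum>z\<in>C. if x = a \<and> y = b then p ^ 5 else 0)
          = (\<Sum>x\<in>A. if x = a then \<Sum>y\<in>B. if y = b then \<Sum>z\<in>C. p ^ 5 else 0 else 0)"
        by (intro sum.cong refl) (auto intro!: sum.cong)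
      moreover have "(\<Sum>x\<in>A. \<Sum>y\<in>B. \<Sum>z\<in>C. if x = a \<and> z = c then p ^ 5 else 0)
          = (\<Sum>x\<in>A. if x = a then \<Sum>y\<in>B. \<Sum>z\<in>C. if z = c then p ^ 5 else 0 else 0)"
        by (intro sum.cong refl) auto
      moreover have "(\<Sum>x\<in>A. \<Sum>y\<in>B. \<Sum>z\<in>C. if y = b \<and> z = c then p ^ 5 else 0)
          = (\<Sum>x\<in>A. \<Sum>y\<in>B. if y = b then \<Sum>z\<in>C. if z = c then p ^ 5 else 0 else 0)"
        by (intro sum.cong refl) auto
      moreover have "(\<Sum>x\<in>A. \<Sum>y\<in>B. \<Sum>z\<in>C. if x = a \<and> y = b \<and> z = c then p ^ 3 else 0)
          = (\<Sum>x\<in>A. if x = a then \<Sum>y\<in>B. if y = b then \<Sum>z\<in>C. if z = c then p ^ 3 else 0 else 0 else 0)"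
        by (intro sum.cong refl) (auto intro!: sum.cong)
      ultimately show ?thesis
        using i(2-4) fin by (simp add: sum.distrib card power3_eq_cube algebra_simps)
    qed
    finally show ?thesis .
  qed
  have upper: "(\<Sum>i\<in>?I. \<Sum>j\<in>?I. measure_pmf.prob ?M {b. ?ev i b \<and> ?ev j b}) \<le> 5 * ?x\<^sup>2"
  proof -
    let ?y = "real m * p"
    have "(\<Sum>i\<in>?I. \<Sum>j\<in>?I. measure_pmf.prob ?M {b. ?ev i b \<and> ?ev j b})
        \<le> (\<Sum>i\<in>?I. real m ^ 3 * p ^ 6 + 3 * real m * p ^ 5 + p ^ 3)"
      by (intro sum_mono row)
    also have "\<dots> = real m ^ 3 * (real m ^ 3 * p ^ 6 + 3 * real m * p ^ 5 + p ^ 3)"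
      by (simp add: card card_cartesian_product power3_eq_cube)
    also have "\<dots> = ?y ^ 6 + 3 * (?y ^ 5 / real m) + ?y ^ 3"
      using assms(1) by (simp add: power_mult_distrib field_simps eval_nat_numeral)
    \<comment> \<open>Since m and mp are at least 1, every overlap term is at most (mp)^6; the
      constant 5 is 1 + 3 + 1.\<close>
    also have "\<dots> \<le> ?y ^ 6 + 3 * ?y ^ 6 + ?y ^ 6"
    proof -
      have "?y ^ 5 / real m \<le> ?y ^ 5 / 1"
        using assms p by (intro divide_left_mono) auto
      then show ?thesis
        using power_increasing[of 5 6 ?y] power_increasing[of 3 6 ?y] assms(2) by simp
    qed
    finally show ?thesis
      by (simp flip: power_mult)
  qed
  have "1 / 5 \<le> measure_pmf.prob ?M {b. \<exists>i\<in>?I. ?ev i b}"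
  proof (rule second_moment_prob)
    show "(\<Sum>i\<in>?I. measure_pmf.prob ?M {b. ?ev i b}) = ?x"
      using prob1 by (simp add: card card_cartesian_product power_mult_distrib power3_eq_cube)
    show "0 < ?x"
      using assms(2) by (intro zero_less_power) linarith
  qed (use fin upper in auto)
  also have "\<dots> \<le> measure_pmf.prob ?M
    {b. \<exists>x y z. {x, y, z} \<subseteq> {1..3 * m} \<and> distinct [x, y, z] \<and> (\<forall>e\<in>triangle x y z. b e)}"
  proof (intro measure_pmf.finite_measure_mono subsetI CollectI)
    fix b assume "b \<in> {b. \<exists>i\<in>?I. ?ev i b}"
    then obtain x y z where "x \<in> A" "y \<in> B" "z \<in> C" "\<forall>e\<in>triangle x y z. b e"
      by auto
    then show "\<exists>x y z. {x, y, z} \<subseteq> {1..3 * m} \<and> distinct [x, y, z] \<and> (\<forall>e\<in>triangle x y z. b e)"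
      using ordered[of x y z] by (intro exI[of _ x] exI[of _ y] exI[of _ z]) simp
  qed simp
  finally show ?thesis .
qed

section \<open>Brooms\<close>

text \<open>An orientation of the broom with out-degree one everywhere: the triangle is the cycle 0,
  2, 1, and each pendant vertex points to the centre 0. Counting edges by their tails bounds the
  density by 1.\<close>

definition partner :: "nat \<Rightarrow> nat" where
  "partner v = (if v = 0 then 2 else if v = 2 then 1 else 0)"

definition broom :: "nat \<Rightarrow> nat sgraph" where
  "broom k = ({..<k + 3}, (\<lambda>v. {v, partner v}) ` {..<k + 3})"

lemma partner_edge_eq_iff: "{u, partner u} = {v, partner v} \<longleftrightarrow> u = v"
  by (auto simp: partner_def doubleton_eq_iff split: if_splits)

lemma verts_broom [simp]: "verts (broom k) = {..<k + 3}"
  by (simp add: broom_def)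

lemma lessThan_plus_3: "{..<k + 3 :: nat} = {0, 1, 2} \<union> {3..<k + 3}"
  by auto

lemma edges_broom: "edges (broom k) = triangle 0 1 2 \<union> (\<lambda>v. {0, v}) ` {3..<k + 3}"
  unfolding broom_def snd_conv lessThan_plus_3 image_Un
  by (auto simp: partner_def triangle_def doubleton_eq_iff)

lemma card_edges_broom: "card (edges (broom k)) = k + 3"
  unfolding broom_def by (simp add: card_image inj_on_def partner_edge_eq_iff)

lemma simple_graph_broom: "simple_graph (broom k)"
  by (auto simp: simple_graph_def broom_def partner_def)

section \<open>Edge density of brooms and their subgraphs\<close>

text \<open>Every edge of a broom has the form \<open>{v, partner v}\<close>: choosing the endpoint \<open>v\<close> is injective.\<close>

lemma card_edges_le_card_verts:
  assumes "G \<in> subgraphs (broom k)"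
  shows "card (edges G) \<le> card (verts G)"
proof -
  have G: "finite (verts G)" "edges G \<subseteq> edges (broom k)" "\<And>e. e \<in> edges G \<Longrightarrow> e \<subseteq> verts G"
    using assms by (auto simp: subgraphs_def simple_graph_def)
  then have "edges G \<subseteq> (\<lambda>v. {v, partner v}) ` verts G"
    unfolding broom_def by fastforce
  then show ?thesis
    using G(1) by (rule surj_card_le[rotated])
qed

text \<open>One edge covers two vertices and two distinct edges cover at least three. The spare
  vertex supplies an extra factor n in the expectation of a subgraph with at most two edges.\<close>

lemma card_edges_less_card_verts:
  assumes "simple_graph G" "edges G \<noteq> {}" "card (edges G) \<le> 2"
  shows "card (edges G) < card (verts G)"
proof -
  have fin: "finite (verts G)" and sub: "\<And>e. e \<in> edges G \<Longrightarrow> e \<subseteq> verts G \<and> card e = 2"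
    using assms(1) by (auto simp: simple_graph_def)
  have finE: "finite (edges G)"
    by (rule finite_subset[of _ "Pow (verts G)"]) (use fin sub in auto)
  have ge: "2 \<le> card (verts G)"
    using assms(2) sub fin card_mono by (metis ex_in_conv)
  consider "card (edges G) < 2" | "card (edges G) = 2"
    using assms(3) by linarith
  then show ?thesis
  proof cases
    case 2
    then obtain e f where ef: "edges G = {e, f}" "e \<noteq> f"
      by (auto simp: card_2_iff)
    then have card: "card e = 2" "card f = 2" "e \<union> f \<subseteq> verts G"
      using sub by auto
    have fin_Un: "finite (e \<union> f)"
      using card(3) fin by (rule finite_subset)
    \<comment> \<open>Otherwise \<open>f\<close> would be contained in \<open>e\<close>, and having
      the same size would equal it.\<close>
    have "e \<noteq> e \<union> f"
      using card fin_Un ef(2) by (metis Un_upper2 card_subset_eq finite_Un)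
    then have "card e < card (e \<union> f)"
      using fin_Un by (intro psubset_card_mono) auto
    also have "\<dots> \<le> card (verts G)"
      using card(3) fin by (intro card_mono)
    finally show ?thesis
      using 2 card by simp
  qed (use ge in simp)
qed

lemma max_density_broom: "max_density (broom k) = 1"
  unfolding max_density_def
proof (rule Max_eqI)
  show "finite ((\<lambda>F. real (card (edges F)) / real (card (verts F))) ` {F \<in> subgraphs (broom k). verts F \<noteq> {}})"
    using finite_subgraphs[of "broom k"] by simp
next
  fix y
  assume "y \<in> (\<lambda>F. real (card (edges F)) / real (card (verts F))) ` {F \<in> subgraphs (broom k). verts F \<noteq> {}}"
  then show "y \<le> 1"
    using card_edges_le_card_verts by (auto simp: divide_le_eq_1)
next
  have "broom k \<in> {F \<in> subgraphs (broom k). verts F \<noteq> {}}"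
    using simple_graph_broom by (auto simp: subgraphs_def lessThan_empty_iff)
  moreover have "1 = real (card (edges (broom k))) / real (card (verts (broom k)))"
    by (simp add: card_edges_broom)
  ultimately show "1 \<in> (\<lambda>F. real (card (edges F)) / real (card (verts F))) ` {F \<in> subgraphs (broom k). verts F \<noteq> {}}"
    by (rule image_eqI[rotated])
qed

text \<open>Degree 2 at the centre is enough to place every p below n^(-1/2) in the first case of
  \<open>M_bound\<close>.\<close>

lemma max_degree_broom_ge: "2 \<le> max_degree (broom k)"
proof -
  have "2 = card {{0, 1}, {0, 2 :: nat}}"
    by (simp add: doubleton_eq_iff)
  also have "\<dots> \<le> card {e \<in> edges (broom k). 0 \<in> e}"
    by (intro card_mono) (auto simp: edges_broom triangle_def)
  also have "\<dots> \<le> max_degree (broom k)"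
    unfolding max_degree_def by (intro Max_ge) auto
  finally show ?thesis .
qed

lemma broom_iso_iff: "broom k \<simeq>\<^sub>g broom l \<longleftrightarrow> k = l"
  using graph_iso_card_verts[of "broom k" "broom l"] by (auto simp: graph_iso_def intro: exI[of _ id])

text \<open>Each k-subset \<open>S\<close> of \<open>D\<close>, attached to \<open>x\<close> as
  pendant vertices, completes the triangle to a broom. Removing the triangle from the vertex set of
  this broom recovers \<open>S\<close>, so the brooms are distinct.\<close>

lemma binomial_le_copy_count_broom:
  assumes fin: "finite (verts G)" and dist: "distinct [x, y, z]"
    and tri: "{x, y, z} \<subseteq> verts G" "triangle x y z \<subseteq> edges G"
    and D: "D \<subseteq> verts G - {x, y, z}" "\<And>v. v \<in> D \<Longrightarrow> {x, v} \<in> edges G"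
  shows "card D choose k \<le> copy_count (broom k) G"
proof -
  let ?C = "{F \<in> subgraphs G. F \<simeq>\<^sub>g broom k}"
  have finC: "finite ?C"
    using finite_subgraphs[OF fin] by simp
  have "{S. S \<subseteq> D \<and> card S = k} \<subseteq> (\<lambda>F. verts F - {x, y, z}) ` ?C"
  proof
    fix S assume "S \<in> {S. S \<subseteq> D \<and> card S = k}"
    then have S: "S \<subseteq> D" "card S = k"
      by auto
    have "finite S"
      using S(1) D(1) fin by (meson finite_Diff finite_subset)
    then obtain g where g: "bij_betw g {3..<k + 3} S"
      using S(2) finite_same_card_bij[of "{3..<k + 3}" S] by auto
    define h where "h v = (if v = 0 then x else if v = 1 then y else if v = 2 then z else g v)" for v :: nat
    let ?F = "({x, y, z} \<union> S, triangle x y z \<union> (\<lambda>v. {x, v}) ` S)"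
    have disj: "{x, y, z} \<inter> S = {}"
      using S(1) D(1) by auto
    have "bij_betw h {0, 1, 2} {x, y, z}"
      using dist by (auto simp: h_def bij_betw_def inj_on_def)
    moreover have "bij_betw h {3..<k + 3} S"
      using g by (rule bij_betw_cong[THEN iffD1, rotated]) (simp add: h_def)
    ultimately have bij: "bij_betw h (verts (broom k)) (verts ?F)"
      unfolding verts_broom lessThan_plus_3 fst_conv using disj by (rule bij_betw_combine)
    have "h ` {3..<k + 3} = S"
      using \<open>bij_betw h {3..<k + 3} S\<close> by (simp add: bij_betw_def)
    then have "(\<lambda>e. h ` e) ` (\<lambda>v. {0, v}) ` {3..<k + 3} = (\<lambda>v. {x, v}) ` S"
      by (auto simp: image_image h_def[of 0])
    moreover have "(\<lambda>e. h ` e) ` triangle 0 1 2 = triangle x y z"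
      by (simp add: triangle_def h_def insert_commute)
    ultimately have edg: "(\<lambda>e. h ` e) ` edges (broom k) = edges ?F"
      unfolding edges_broom image_Un by simp
    have "?F \<simeq>\<^sub>g broom k"
      using bij edg by (intro graph_iso_sym[OF simple_graph_broom]) (auto simp only: graph_iso_def)
    moreover have "simple_graph ?F"
      using dist disj \<open>finite S\<close> by (auto simp: simple_graph_def triangle_def card_insert_if)
    then have "?F \<in> subgraphs G"
      using tri D S(1) by (auto simp: subgraphs_def)
    moreover have "verts ?F - {x, y, z} = S"
      using disj by auto
    ultimately show "S \<in> (\<lambda>F. verts F - {x, y, z}) ` ?C"
      by (intro image_eqI[of _ _ ?F]) simp_all
  qed
  then have "card {S. S \<subseteq> D \<and> card S = k} \<le> card ((\<lambda>F. verts F - {x, y, z}) ` ?C)"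
    using finC by (intro card_mono) auto
  also have "\<dots> \<le> card ?C"
    using finC by (rule card_image_le)
  finally show ?thesis
    using D(1) fin by (simp add: n_subsets copy_count_def finite_subset)
qed

section \<open>The upper tail of brooms\<close>

text \<open>First expose the pairs inside \<open>{1..3 * m}\<close> and find a triangle there with
  probability at least 1/5. Then ask for \<open>d\<close> edges from its vertex \<open>x\<close> to
  the \<open>N\<close> later vertices. These pairs are still unexposed, and a triangle with such a
  star contains at least (d/k)^k brooms.\<close>

lemma upper_tail_prob_broom_ge:
  fixes p :: real
  assumes m: "1 \<le> m" "1 \<le> real m * p" "3 * m \<le> n" and p: "0 \<le> p" "p \<le> 1"
    and d: "1 \<le> k" "k \<le> d" "(1 + \<epsilon>) * mu (broom k) n p \<le> (real d / real k) ^ k"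
    and N: "N = n - 3 * m"
  shows "1 / 5 * (real (N choose d) * p ^ d * (1 - p) ^ (N - d)) \<le> upper_tail_prob (broom k) \<epsilon> n p"
proof -
  let ?A = "vertex_pairs (3 * m)" and ?V = "{3 * m + 1..n}"
  let ?B = "vertex_pairs n - ?A"
  let ?G = "\<lambda>b. ({1..n}, {e. e \<subseteq> {1..n} \<and> card e = 2 \<and> b e})"
  let ?T = "\<lambda>x y z f. {x, y, z} \<subseteq> {1..3 * m} \<and> distinct [x, y, z] \<and> (\<forall>e\<in>triangle x y z. f e)"
  let ?q = "real (N choose d) * p ^ d * (1 - p) ^ (N - d)"
  let ?X = "{b. (1 + \<epsilon>) * mu (broom k) n p \<le> real (copy_count (broom k) (?G b))}"
  let ?Q = "\<lambda>f g. \<exists>x y z. ?T x y z f \<and> d \<le> card {e \<in> (\<lambda>v. {x, v}) ` ?V. g e}"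
  have inj: "inj_on (\<lambda>v. {x, v}) V" for x :: nat and V
    by (auto simp: inj_on_def doubleton_eq_iff)
  have split: "?A \<union> ?B = vertex_pairs n"
    using m(3) by auto
  have "measure_pmf.prob (bernoulli_product ?A p) {f. \<exists>x y z. ?T x y z f} * ?q
      \<le> measure_pmf.prob (bernoulli_product (?A \<union> ?B) p) ?X"
  proof (rule prob_two_stage)
    show "finite ?A" "finite ?B" "?A \<inter> ?B = {}" "0 \<le> ?q"
      using p by auto
  next
    fix f assume "\<exists>x y z. ?T x y z f"
    then obtain x y z where T: "?T x y z f"
      by blast
    let ?S = "(\<lambda>v. {x, v}) ` ?V"
    have "card ?S = N"
      using inj by (simp add: card_image N)
    moreover have "?S \<subseteq> ?B"
      using T m(3) by auto
    ultimately have "?q \<le> measure_pmf.prob (bernoulli_product ?B p) {g. d \<le> card {e \<in> ?S. g e}}"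
      using prob_count_ge[of ?B ?S p d] p by simp
    also have "\<dots> \<le> measure_pmf.prob (bernoulli_product ?B p) {g. ?Q f g}"
      using T by (intro measure_pmf.finite_measure_mono) auto
    finally show "?q \<le> measure_pmf.prob (bernoulli_product ?B p) {g. ?Q f g}" .
  next
    fix f g assume "?Q f g"
    then obtain x y z where T: "?T x y z f" and card: "d \<le> card {e \<in> (\<lambda>v. {x, v}) ` ?V. g e}"
      by blast
    let ?h = "\<lambda>e. if e \<in> ?A then f e else g e"
    let ?D = "{v \<in> ?V. g {x, v}}"
    have "{e \<in> (\<lambda>v. {x, v}) ` ?V. g e} = (\<lambda>v. {x, v}) ` ?D"
      by auto
    then have "d \<le> card ?D"
      using card inj by (simp add: card_image)
    have sub: "triangle x y z \<subseteq> ?A"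
      using T by (auto simp: triangle_def)
    have "card ?D choose k \<le> copy_count (broom k) (?G ?h)"
    proof (rule binomial_le_copy_count_broom)
      show "{x, y, z} \<subseteq> verts (?G ?h)"
        using T m(3) by auto
      have "triangle x y z \<subseteq> vertex_pairs n"
        using sub m(3) by fastforce
      then show "triangle x y z \<subseteq> edges (?G ?h)"
        using T sub by auto
      show "?D \<subseteq> verts (?G ?h) - {x, y, z}"
        using T by auto
    next
      fix v assume "v \<in> ?D"
      then show "{x, v} \<in> edges (?G ?h)"
        using T m(3) by auto
    qed (use T in auto)
    then have "real (card ?D choose k) \<le> real (copy_count (broom k) (?G ?h))"
      by (rule of_nat_mono)
    moreover have "(real (card ?D) / real k) ^ k \<le> real (card ?D choose k)"
      using d(2) \<open>d \<le> card ?D\<close> by (intro binomial_ge_n_over_k_pow_k) simp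
    moreover have "(real d / real k) ^ k \<le> (real (card ?D) / real k) ^ k"
      using \<open>d \<le> card ?D\<close> by (intro power_mono divide_right_mono) auto
    ultimately show "?h \<in> ?X"
      using d(3) by (intro CollectI) linarith
  qed
  moreover have "1 / 5 * ?q
      \<le> measure_pmf.prob (bernoulli_product ?A p) {f. \<exists>x y z. ?T x y z f} * ?q"
    using prob_triangle_ge[OF m(1,2) p(2)] p by (intro mult_right_mono) auto
  moreover have "upper_tail_prob (broom k) \<epsilon> n p = measure_pmf.prob (bernoulli_product (vertex_pairs n) p) ?X"
    by (simp add: upper_tail_prob_def gnp_def vimage_def)
  ultimately show ?thesis
    unfolding split by linarith
qed

text \<open>Combines the bound (N/d)^d for the binomial coefficient with 1 - p >= exp(-2p), valid
  for p up to 1/2; the exponent N - d is raised to N.\<close>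

lemma binomial_prob_ge_exp:
  fixes p :: real
  assumes p: "0 < p" "p \<le> 1 / 2" and d: "1 \<le> d" "d \<le> N"
  shows "exp (- (real d * ln (real d / (real N * p)) + 2 * p * real N))
    \<le> real (N choose d) * p ^ d * (1 - p) ^ (N - d)"
proof -
  have "- (2 * p) \<le> - p - 2 * p\<^sup>2"
    using p by (simp add: power2_eq_square)
  also have "\<dots> \<le> ln (1 - p)"
    using p by (intro ln_one_minus_pos_lower_bound) auto
  finally have "exp (- (2 * p)) \<le> 1 - p"
    using p by (simp add: ln_ge_iff)
  have "exp (- (real d * ln (real d / (real N * p)) + 2 * p * real N))
      = exp (ln (real N * p / real d)) ^ d * exp (- (2 * p)) ^ N"
    using p d by (simp add: ln_div exp_add[symmetric] exp_of_nat_mult[symmetric] algebra_simps)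
  also have "exp (ln (real N * p / real d)) = real N * p / real d"
    using p d by simp
  also have "(real N * p / real d) ^ d * exp (- (2 * p)) ^ N \<le> (real N * p / real d) ^ d * (1 - p) ^ N"
    using \<open>exp (- (2 * p)) \<le> 1 - p\<close> p by (intro mult_left_mono power_mono) auto
  also have "\<dots> \<le> (real N * p / real d) ^ d * (1 - p) ^ (N - d)"
    using p by (intro mult_left_mono power_decreasing) auto
  also have "(real N * p / real d) ^ d = (real N / real d) ^ d * p ^ d"
    by (simp add: power_mult_distrib power_divide)
  also have "\<dots> * (1 - p) ^ (N - d) \<le> real (N choose d) * p ^ d * (1 - p) ^ (N - d)"
    using p binomial_ge_n_over_k_pow_k[OF d(2), where ?'a = real] by (intro mult_right_mono) auto
  finally show ?thesis .
qed

section \<open>First-moment bounds from above and below\<close>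

lemma mu_le_power:
  fixes p :: real
  assumes "simple_graph G" "0 \<le> p" "p \<le> 1"
  shows "mu G n p \<le> real n ^ card (verts G) * p ^ card (edges G)"
proof -
  have "real (card (copies G n)) \<le> real n ^ card (verts G)"
    using card_copies_le[OF assms(1), of n] by (metis of_nat_le_iff of_nat_power)
  then show ?thesis
    unfolding mu_eq_card_copies[OF assms(2,3)] using assms(2) by (intro mult_right_mono) auto
qed

lemma mu_ge_power:
  fixes p :: real
  assumes "simple_graph G" "0 \<le> p" "p \<le> 1" "card (verts G) \<le> n"
  shows "(real n / real (card (verts G))) ^ card (verts G) * p ^ card (edges G) \<le> mu G n p"
proof -
  have "(real n / real (card (verts G))) ^ card (verts G) \<le> real (n choose card (verts G))"
    using assms(4) by (rule binomial_ge_n_over_k_pow_k)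
  also have "\<dots> \<le> real (card (copies G n))"
    using binomial_le_card_copies[OF assms(1), of n] by simp
  finally show ?thesis
    unfolding mu_eq_card_copies[OF assms(2,3)] using assms(2) by (intro mult_right_mono) auto
qed

text \<open>A star with about C \<omega>^2 leaves suffices: with \<open>C\<close> = k(1 +
  \<epsilon>), (d/k)^k is at least (1 + \<epsilon>)^k \<omega>^(2k). This exceeds (1 + \<epsilon>)
  times the expectation, which is at most \<omega>^(k+3), because 2k >= k + 3.\<close>

lemma neg_ln_upper_tail_prob_broom_le:
  fixes p \<epsilon> :: real and k n :: nat
  defines "\<omega> \<equiv> real n * p" and "C \<equiv> real k * (1 + \<epsilon>)"
  assumes "3 \<le> k" "0 < \<epsilon>" "0 < p" "p \<le> 1 / 2" "8 \<le> n" "8 \<le> \<omega>" "8 * C * \<omega>\<^sup>2 \<le> real n"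
  shows "0 < upper_tail_prob (broom k) \<epsilon> n p"
    and "- ln (upper_tail_prob (broom k) \<epsilon> n p) \<le> ln 5 + 2 * C * \<omega>\<^sup>2 * ln (8 * C * \<omega>) + 2 * \<omega>"
proof -
  \<comment> \<open>A quarter of n keeps both stages linear in size: the triangle lives on 3m
    vertices and at least n/4 vertices remain for the star.\<close>
  define m where "m = n div 4"
  define N where "N = n - 3 * m"
  define d where "d = nat \<lceil>C * \<omega>\<^sup>2\<rceil>"
  let ?P = "upper_tail_prob (broom k) \<epsilon> n p"
  have k: "3 \<le> real k" "1 \<le> real k"
    using assms(3) by auto
  have "real k \<le> C"
    unfolding C_def using k assms(4) by simp
  then have C: "3 \<le> C" "0 < C"
    using k by auto
  have omega2: "1 \<le> \<omega>\<^sup>2"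
    using assms(8) by (intro one_le_power) simp
  have m: "real n / 8 \<le> real m" "4 * m \<le> n"
    unfolding m_def using assms(7) by linarith+
  have N: "real n / 4 \<le> real N" "real N \<le> real n"
    unfolding N_def using m(2) by auto
  have C_le: "C \<le> C * \<omega>\<^sup>2"
    using omega2 C by simp
  \<comment> \<open>The rounding is absorbed by the factor 2, since C \<omega>^2 is at least
    1.\<close>
  have d: "C * \<omega>\<^sup>2 \<le> real d" "real d \<le> 2 * C * \<omega>\<^sup>2"
    unfolding d_def using C_le C by linarith+
  have "d \<le> N" "k \<le> d"
    using d N(1) assms(9) C_le \<open>real k \<le> C\<close> by linarith+
  have mu: "(1 + \<epsilon>) * mu (broom k) n p \<le> (real d / real k) ^ k"
  proof -
    have "mu (broom k) n p \<le> real n ^ (k + 3) * p ^ (k + 3)"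
      using mu_le_power[OF simple_graph_broom[of k], of p n] assms(5,6) by (simp add: card_edges_broom)
    then have "(1 + \<epsilon>) * mu (broom k) n p \<le> (1 + \<epsilon>) * \<omega> ^ (k + 3)"
      using assms(4) by (intro mult_left_mono) (simp_all add: \<omega>_def power_mult_distrib)
    also have "\<dots> \<le> (1 + \<epsilon>) ^ k * \<omega> ^ (2 * k)"
      using assms(3,4,8) by (intro mult_mono power_increasing self_le_power) auto
    also have "\<dots> = ((1 + \<epsilon>) * \<omega>\<^sup>2) ^ k"
      by (simp add: power_mult_distrib power_mult)
    also have "\<dots> \<le> (real d / real k) ^ k"
      using d(1) k assms(4) by (intro power_mono) (simp_all add: C_def field_simps)
    finally show ?thesis .
  qed
  have mp: "1 \<le> real m * p"
  proof -
    have "1 \<le> real n / 8 * p"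
      using assms(8) by (simp add: \<omega>_def)
    also have "\<dots> \<le> real m * p"
      using m(1) assms(5) by (intro mult_right_mono) auto
    finally show ?thesis .
  qed
  let ?c = "real d * ln (real d / (real N * p)) + 2 * p * real N"
  have "1 / 5 * exp (- ?c) \<le> 1 / 5 * (real (N choose d) * p ^ d * (1 - p) ^ (N - d))"
    using binomial_prob_ge_exp[OF assms(5,6) _ \<open>d \<le> N\<close>] \<open>k \<le> d\<close> assms(3) by simp
  also have "\<dots> \<le> ?P"
  proof (rule upper_tail_prob_broom_ge)
    show "1 \<le> m" "3 * m \<le> n"
      using m assms(7) by linarith+
  qed (use mp mu \<open>k \<le> d\<close> assms(3,5,6) N_def in auto)
  finally have P: "1 / 5 * exp (- ?c) \<le> ?P" .
  then show pos: "0 < ?P"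
    by (rule less_le_trans[rotated]) simp
  have "ln (1 / 5 * exp (- ?c)) \<le> ln ?P"
    using P pos by (subst ln_le_cancel_iff) auto
  then have "- ln ?P \<le> ln 5 + ?c"
    by (simp add: ln_mult ln_div)
  also have "?c \<le> 2 * C * \<omega>\<^sup>2 * ln (8 * C * \<omega>) + 2 * \<omega>"
  proof (intro add_mono)
    have Np: "\<omega> / 4 \<le> real N * p"
      using mult_right_mono[OF N(1), of p] assms(5) by (simp add: \<omega>_def)
    have "real d / (real N * p) \<le> (2 * C * \<omega>\<^sup>2) / (\<omega> / 4)"
      using d(2) Np assms(8) C by (intro frac_le) auto
    also have "\<dots> = 8 * C * \<omega>"
      using assms(8) by (simp add: power2_eq_square)
    finally have ratio: "real d / (real N * p) \<le> 8 * C * \<omega>" .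
    have "0 < real d" "0 < real N * p"
      using d(1) C_le C Np assms(8) by linarith+
    then have ln: "ln (real d / (real N * p)) \<le> ln (8 * C * \<omega>)"
      using ratio by (intro ln_mono) auto
    \<comment> \<open>The logarithm is replaced by its upper bound first; that bound has to be
      nonnegative before \<open>d\<close> may be replaced by its own upper bound.\<close>
    have "1 \<le> 8 * C * \<omega>"
      using mult_mono[of 1 "8 * C" 1 \<omega>] C assms(8) by simp
    then have "0 \<le> ln (8 * C * \<omega>)"
      by simp
    then show "real d * ln (real d / (real N * p)) \<le> 2 * C * \<omega>\<^sup>2 * ln (8 * C * \<omega>)"
      using mult_left_mono[OF ln, of "real d"] mult_right_mono[OF d(2), of "ln (8 * C * \<omega>)"] by simp
    show "2 * p * real N \<le> 2 * \<omega>"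
      using N(2) assms(5) by (simp add: \<omega>_def)
  qed
  finally show "- ln ?P \<le> ln 5 + 2 * C * \<omega>\<^sup>2 * ln (8 * C * \<omega>) + 2 * \<omega>"
    by simp
qed

section \<open>Asymptotics\<close>

lemma frac_indep_number_nonneg:
  assumes "finite (verts G)"
  shows "0 \<le> frac_indep_number G"
proof -
  let ?S = "{(\<Sum>v\<in>verts G. f v) | f :: 'a \<Rightarrow> real.
    (\<forall>v\<in>verts G. 0 \<le> f v \<and> f v \<le> 1) \<and> (\<forall>u v. {u, v} \<in> edges G \<longrightarrow> f u + f v \<le> 1)}"
  have "0 \<in> ?S"
    by (intro CollectI exI[of _ "\<lambda>_. 0"]) simp
  moreover have "bdd_above ?S"
  proof (rule bdd_aboveI)
    fix s assume "s \<in> ?S"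
    then show "s \<le> (\<Sum>v\<in>verts G. 1)"
      by (auto intro!: sum_mono simp del: sum_constant)
  qed
  ultimately show ?thesis
    unfolding frac_indep_number_def by (rule cSup_upper)
qed

text \<open>Up to the constant \<open>K\<close>, the expectation is at least n^(v-e) \<omega>^e.
  With three or more edges, e <= v leaves at least \<omega>^3; with at most two edges there is a
  spare factor n, which is at least \<omega>^3.\<close>

lemma mu_subgraph_broom_ge:
  fixes p :: real and k n :: nat
  defines "\<omega> \<equiv> real n * p" and "K \<equiv> real (k + 3) ^ (k + 3)"
  assumes G: "G \<in> subgraphs (broom k)" "edges G \<noteq> {}"
    and p: "0 \<le> p" "p \<le> 1" and n: "k + 3 \<le> n" "1 \<le> \<omega>" "\<omega> ^ 3 \<le> real n"
  shows "\<omega> ^ 3 / K \<le> mu G n p"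
proof -
  define v e where "v = card (verts G)" and "e = card (edges G)"
  have simple: "simple_graph G" and "verts G \<subseteq> {..<k + 3}"
    using G(1) by (auto simp: subgraphs_def)
  then have v: "v \<le> k + 3"
    unfolding v_def using card_mono[of "{..<k + 3}" "verts G"] by simp
  have "edges G \<subseteq> Pow (verts G)" "finite (verts G)"
    using simple by (auto simp: simple_graph_def)
  then have "finite (edges G)"
    by (meson finite_Pow_iff finite_subset)
  then have "0 < e"
    unfolding e_def using G(2) by (simp add: card_gt_0_iff)
  have ev: "e \<le> v"
    unfolding v_def e_def using G(1) by (rule card_edges_le_card_verts)
  have n1: "1 \<le> real n"
    using n(1) by simp
  have "\<omega> ^ 3 \<le> real n ^ (v - e) * \<omega> ^ e"
  proof (cases "e \<le> 2")
    case True
    then have "0 < v - e"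
      using card_edges_less_card_verts[OF simple G(2)] by (simp add: v_def e_def)
    then have "real n \<le> real n ^ (v - e)"
      using n1 by (intro self_le_power) auto
    then have "\<omega> ^ 3 \<le> real n ^ (v - e) * 1"
      using n(3) by linarith
    also have "\<dots> \<le> real n ^ (v - e) * \<omega> ^ e"
      using n(2) by (intro mult_left_mono) auto
    finally show ?thesis .
  next
    case False
    then have "1 * \<omega> ^ 3 \<le> real n ^ (v - e) * \<omega> ^ e"
      using n1 n(2) by (intro mult_mono power_increasing one_le_power) auto
    then show ?thesis
      by simp
  qed
  also have "\<dots> = real n ^ v * p ^ e"
    using ev by (simp add: \<omega>_def power_mult_distrib flip: power_add)
  finally have "\<omega> ^ 3 / K \<le> real n ^ v * p ^ e / K"
    by (intro divide_right_mono) (simp_all add: K_def)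
  also have "\<dots> \<le> real n ^ v * p ^ e / real v ^ v"
  proof (intro divide_left_mono)
    have "real v ^ v \<le> real (k + 3) ^ v"
      using v by (intro power_mono) auto
    also have "\<dots> \<le> K"
      unfolding K_def using v by (intro power_increasing) auto
    finally show "real v ^ v \<le> K" .
  qed (use \<open>0 < e\<close> ev p in \<open>auto simp: K_def\<close>)
  also have "\<dots> = (real n / real v) ^ v * p ^ e"
    by (simp add: power_divide)
  also have "\<dots> \<le> mu G n p"
    unfolding v_def e_def using v n(1) by (intro mu_ge_power[OF simple p]) (simp add: v_def)
  finally show ?thesis .
qed

text \<open>For the second term a crude bound is enough: all expectations are at least 1, hence so
  is \<open>M_bound\<close>, and log(1/p) is at least half of log n, which dominates
  \<omega>^3.\<close>

lemma min_Phi_M_bound_broom_ge: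
  fixes p :: real and k n :: nat
  defines "\<omega> \<equiv> real n * p" and "K \<equiv> real (k + 3) ^ (k + 3)"
  assumes p: "p < real n powr (- 1 / 2)"
    and n: "k + 3 \<le> n" "1 \<le> \<omega>" "\<omega> ^ 3 \<le> ln (real n)" "K \<le> \<omega> ^ 3"
  shows "\<omega> ^ 3 / K \<le> min (Phi (broom k) n p) (M_bound (broom k) n p * ln (1 / p))"
proof -
  let ?\<G> = "{G \<in> subgraphs (broom k). edges G \<noteq> {}}"
  have n1: "1 < real n"
    using n(1) by simp
  have p0: "0 < p"
    using n(2) n1 by (smt (verit) \<omega>_def mult_nonneg_nonpos)
  have "real n powr (- 1 / 2) \<le> real n powr 0"
    using n1 by (intro powr_mono) auto
  then have p1: "p \<le> 1"
    using p n1 by simp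
  have "ln (real n) \<le> real n"
    using ln_le_minus_one[of "real n"] n1 by simp
  then have mu: "\<omega> ^ 3 / K \<le> mu G n p" if "G \<in> ?\<G>" for G
    using that n p0 p1 unfolding \<omega>_def K_def by (intro mu_subgraph_broom_ge) auto
  have fin: "finite ?\<G>"
    using finite_subgraphs[of "broom k"] by simp
  have "broom k \<in> ?\<G>"
    using simple_graph_broom by (auto simp: subgraphs_def edges_broom triangle_def)
  then have ne: "?\<G> \<noteq> {}"
    by blast
  have Phi: "\<omega> ^ 3 / K \<le> Phi (broom k) n p"
    unfolding Phi_def using fin ne mu by (intro Min.boundedI) auto
  have K: "2 \<le> K"
    unfolding K_def using self_le_power[of "real (k + 3)" "k + 3"] by simp
  have "real n powr (- 1 / 2) \<le> real n powr (- 1 / real (max_degree (broom k)))"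
    using n1 max_degree_broom_ge[of k] by (intro powr_mono) (auto simp: field_simps)
  then have "M_bound (broom k) n p = Min ((\<lambda>G. mu G n p powr (1 / frac_indep_number G)) ` ?\<G>)"
    unfolding M_bound_def using p by simp
  also have "1 \<le> \<dots>"
  proof (intro Min.boundedI)
    fix y assume "y \<in> (\<lambda>G. mu G n p powr (1 / frac_indep_number G)) ` ?\<G>"
    then obtain G where G: "G \<in> ?\<G>" "y = mu G n p powr (1 / frac_indep_number G)"
      by blast
    have "1 \<le> \<omega> ^ 3 / K"
      using n(4) K by simp
    then have "1 \<le> mu G n p"
      using mu[OF G(1)] by linarith
    moreover have "finite (verts G)"
      using G(1) by (auto simp: subgraphs_def simple_graph_def)
    \<comment> \<open>Nonnegativity suffices here: for the value 0 the exponent would be 1/0 = 0,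
      and the power would still be 1.\<close>
    then have "0 \<le> frac_indep_number G"
      by (rule frac_indep_number_nonneg)
    ultimately show "1 \<le> y"
      unfolding G(2) by (intro ge_one_powr_ge_zero) auto
  qed (use fin ne in auto)
  finally have M: "1 \<le> M_bound (broom k) n p" .
  have "ln p \<le> ln (real n powr (- 1 / 2))"
    using p p0 n1 by (intro ln_mono) auto
  then have ln: "ln (real n) / 2 \<le> ln (1 / p)"
    using p0 n1 by (simp add: ln_div ln_powr)
  have "\<omega> ^ 3 / K \<le> \<omega> ^ 3 / 2"
    using K n(2) by (intro divide_left_mono) auto
  also have "\<dots> \<le> 1 * ln (1 / p)"
    using n(3) ln by simp
  also have "\<dots> \<le> M_bound (broom k) n p * ln (1 / p)"
    using M p0 p1 by (intro mult_right_mono) auto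
  finally show ?thesis
    using Phi by simp
qed

section \<open>Comparison of the two bounds as n tends to infinity\<close>

lemma neg_ln_upper_tail_prob_broom_smallo:
  fixes p :: "nat \<Rightarrow> real" and \<epsilon> :: real
  assumes "3 \<le> k" "0 < \<epsilon>"
    and lower: "(\<lambda>n. real n powr (- 1)) \<in> o(p)"
    and upper: "p \<in> o(\<lambda>n. real n powr (- 1) * ln (real n) powr (1 / 3))"
    and p: "\<And>n. 0 \<le> p n"
  shows "\<forall>\<^sub>F n in sequentially. 0 < upper_tail_prob (broom k) \<epsilon> n (p n)"
    and "(\<lambda>n. - ln (upper_tail_prob (broom k) \<epsilon> n (p n)))
      \<in> o(\<lambda>n. min (Phi (broom k) n (p n)) (M_bound (broom k) n (p n) * ln (1 / p n)))"
proof -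
  define \<omega> where "\<omega> n = real n * p n" for n
  define C where "C = real k * (1 + \<epsilon>)"
  define K where "K = real (k + 3) ^ (k + 3)"
  define g where "g x = ln 5 + 2 * C * x\<^sup>2 * ln (8 * C * x) + 2 * x" for x
  let ?P = "\<lambda>n. upper_tail_prob (broom k) \<epsilon> n (p n)"
  have C: "0 < C"
    unfolding C_def using assms(1,2) by simp
  have large: "\<forall>\<^sub>F n in sequentially. c \<le> \<omega> n" for c
  proof -
    \<comment> \<open>The little-o constant 1/(|c| + 1) is positive for every real \<open>c\<close>
      and turns the hypothesis into \<omega> >= |c| + 1.\<close>
    have "\<forall>\<^sub>F n in sequentially. norm (real n powr (- 1)) \<le> 1 / (\<bar>c\<bar> + 1) * norm (p n)"
      using lower by (rule landau_o.smallD) simp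
    then show ?thesis
      using eventually_gt_at_top[of 0]
    proof eventually_elim
      case (elim n)
      then have "\<bar>c\<bar> + 1 \<le> real n * p n"
        using p[of n] by (simp add: powr_minus field_simps)
      then show ?case
        by (simp add: \<omega>_def)
    qed
  qed
  have omega_top: "filterlim \<omega> at_top sequentially"
    unfolding filterlim_at_top using large by blast
  have cube: "\<forall>\<^sub>F n in sequentially. \<omega> n ^ 3 \<le> ln (real n)"
  proof -
    have "\<forall>\<^sub>F n in sequentially. norm (p n) \<le> 1 * norm (real n powr (- 1) * ln (real n) powr (1 / 3))"
      using upper by (rule landau_o.smallD) simp
    then show ?thesis
      using eventually_gt_at_top[of 1]
    proof eventually_elim
      case (elim n)
      then have "\<omega> n \<le> ln (real n) powr (1 / 3)"
        using p[of n] by (simp add: \<omega>_def powr_minus field_simps)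
      then have "\<omega> n ^ 3 \<le> (ln (real n) powr (1 / 3)) ^ 3"
        using p[of n] by (intro power_mono) (simp_all add: \<omega>_def)
      also have "\<dots> = ln (real n)"
        using elim by (simp add: powr_powr flip: powr_numeral)
      finally show ?case .
    qed
  qed
  have "\<forall>\<^sub>F n in sequentially. ln (real n) < sqrt (real n)"
    and "\<forall>\<^sub>F n in sequentially. 2 * ln (real n) \<le> real n"
    by real_asymp+
  then have ev: "\<forall>\<^sub>F n in sequentially. 0 < ?P n \<and> - ln (?P n) \<le> g (\<omega> n)
      \<and> \<omega> n ^ 3 / K \<le> min (Phi (broom k) n (p n)) (M_bound (broom k) n (p n) * ln (1 / p n))"
    using large[of "8 * C"] large[of K] large[of 8] cube eventually_ge_at_top[of "k + 8"]
  proof eventually_elim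
    case (elim n)
    have n: "0 < real n"
      using elim by simp
    have "\<omega> n \<le> \<omega> n ^ 3"
      using elim by (intro self_le_power) auto
    \<comment> \<open>From \<omega> <= \<omega>^3 <= ln n: the comparison of ln n with n/2 gives p
      <= 1/2, and the one with the square root of n gives p < n^(-1/2).\<close>
    then have "\<omega> n \<le> real n / 2" "\<omega> n < sqrt (real n)"
      using elim by linarith+
    then have "p n \<le> 1 / 2" "p n < sqrt (real n) / real n"
      using n by (simp_all add: \<omega>_def field_simps)
    moreover have "sqrt (real n) / real n = real n powr (- 1 / 2)"
      using n by (simp add: powr_minus powr_half_sqrt real_div_sqrt field_simps)
    moreover have "0 < p n"
      using elim p[of n] by (cases "p n = 0") (auto simp: \<omega>_def)
    moreover have "8 * C * (\<omega> n)\<^sup>2 \<le> real n"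
    proof -
      \<comment> \<open>As 8C is eventually at most \<omega>, the side condition on the size of the
        star reduces to \<omega>^3 <= ln n <= n.\<close>
      have "8 * C * (\<omega> n)\<^sup>2 \<le> \<omega> n * (\<omega> n)\<^sup>2"
        using elim by (intro mult_right_mono) auto
      also have "\<dots> \<le> real n"
        using elim n ln_le_minus_one[OF n] by (simp add: power2_eq_square power3_eq_cube)
      finally show ?thesis .
    qed
    ultimately show ?case
      using neg_ln_upper_tail_prob_broom_le[of k \<epsilon> "p n" n] min_Phi_M_bound_broom_ge[of "p n" n k]
        assms(1,2) elim \<open>\<omega> n \<le> \<omega> n ^ 3\<close> unfolding \<omega>_def g_def C_def K_def by auto
  qed
  then show "\<forall>\<^sub>F n in sequentially. 0 < ?P n"
    by eventually_elim simp
  have "(\<lambda>n. - ln (?P n)) \<in> O(\<lambda>n. g (\<omega> n))"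
  proof (rule landau_o.big_mono)
    show "\<forall>\<^sub>F n in sequentially. norm (- ln (?P n)) \<le> norm (g (\<omega> n))"
      using ev
    proof eventually_elim
      case (elim n)
      \<comment> \<open>This makes the negative logarithm nonnegative, so that the upper bound on it
        also bounds its norm.\<close>
      moreover have "?P n \<le> 1"
        by (simp add: upper_tail_prob_def)
      ultimately show ?case
        by auto
    qed
  qed
  also have "(\<lambda>n. g (\<omega> n)) \<in> o(\<lambda>n. \<omega> n ^ 3)"
  proof (rule landau_o.small.compose[OF _ omega_top])
    \<comment> \<open>The leading term of \<open>g\<close> is of order x^2 log x; this logarithmic
      loss is what the third power coming from the triangle beats.\<close>
    show "g \<in> o(\<lambda>x. x ^ 3)"
      unfolding g_def using C by real_asymp
  qed
  also have "(\<lambda>n. \<omega> n ^ 3) \<in> O(\<lambda>n. min (Phi (broom k) n (p n)) (M_bound (broom k) n (p n) * ln (1 / p n)))"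
  proof (rule bigoI[of _ K])
    have "0 < K"
      by (simp add: K_def)
    show "\<forall>\<^sub>F n in sequentially. norm (\<omega> n ^ 3)
        \<le> K * norm (min (Phi (broom k) n (p n)) (M_bound (broom k) n (p n) * ln (1 / p n)))"
      using ev
    proof eventually_elim
      case (elim n)
      let ?min = "min (Phi (broom k) n (p n)) (M_bound (broom k) n (p n) * ln (1 / p n))"
      have "norm (\<omega> n ^ 3) = K * (\<omega> n ^ 3 / K)"
        using p[of n] \<open>0 < K\<close> by (simp add: \<omega>_def)
      also have "\<dots> \<le> K * norm ?min"
        using elim \<open>0 < K\<close> by (intro mult_left_mono order_trans[OF _ abs_ge_self[of ?min, folded real_norm_def]]) auto
      finally show ?case .
    qed
  qed
  finally show "(\<lambda>n. - ln (?P n))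
      \<in> o(\<lambda>n. min (Phi (broom k) n (p n)) (M_bound (broom k) n (p n) * ln (1 / p n)))" .
qed

theorem theorem1:
  shows "\<exists>\<H> :: nat sgraph set.
    infinite \<H> \<and>
    (\<forall>H\<in>\<H>. simple_graph H \<and> edges H \<noteq> {}) \<and>
    (\<forall>G\<in>\<H>. \<forall>H\<in>\<H>. G \<simeq>\<^sub>g H \<longrightarrow> G = H) \<and>
    (\<forall>H\<in>\<H>. \<exists>c::real. c > 0 \<and>
      (\<forall>(\<epsilon>::real) (p :: nat \<Rightarrow> real).
        \<epsilon> > 0 \<longrightarrow>
        (\<forall>n. 0 \<le> p n \<and> p n \<le> 1) \<longrightarrow>
        (\<lambda>n. real n powr (- 1 / max_density H)) \<in> o(p) \<longrightarrow>
        p \<in> o(\<lambda>n. real n powr (- 1 / max_density H) * ln (real n) powr c) \<longrightarrow>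
        (\<forall>\<^sub>F n in sequentially. upper_tail_prob H \<epsilon> n (p n) > 0) \<and>
        (\<lambda>n. - ln (upper_tail_prob H \<epsilon> n (p n)))
          \<in> o(\<lambda>n. min (Phi H n (p n)) (M_bound H n (p n) * ln (1 / p n)))))"
proof (intro exI[of _ "broom ` {3..}"] conjI)
  \<comment> \<open>Brooms with different k have different vertex sets.\<close>
  have "inj broom"
    by (auto simp: inj_def broom_def)
  then show "infinite (broom ` {3..})"
    by (meson finite_imageD infinite_Ici inj_on_subset subset_UNIV)
  show "\<forall>H\<in>broom ` {3..}. simple_graph H \<and> edges H \<noteq> {}"
    by (auto simp: simple_graph_broom edges_broom triangle_def)
  show "\<forall>G\<in>broom ` {3..}. \<forall>H\<in>broom ` {3..}. G \<simeq>\<^sub>g H \<longrightarrow> G = H"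
    by (auto simp: broom_iso_iff)
  show "\<forall>H\<in>broom ` {3..}. \<exists>c::real. c > 0 \<and>
      (\<forall>(\<epsilon>::real) (p :: nat \<Rightarrow> real).
        \<epsilon> > 0 \<longrightarrow>
        (\<forall>n. 0 \<le> p n \<and> p n \<le> 1) \<longrightarrow>
        (\<lambda>n. real n powr (- 1 / max_density H)) \<in> o(p) \<longrightarrow>
        p \<in> o(\<lambda>n. real n powr (- 1 / max_density H) * ln (real n) powr c) \<longrightarrow>
        (\<forall>\<^sub>F n in sequentially. upper_tail_prob H \<epsilon> n (p n) > 0) \<and>
        (\<lambda>n. - ln (upper_tail_prob H \<epsilon> n (p n)))
          \<in> o(\<lambda>n. min (Phi H n (p n)) (M_bound H n (p n) * ln (1 / p n))))"
  proof (intro ballI exI[of _ "1 / 3 :: real"] conjI allI impI, goal_cases)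
    case (2 H \<epsilon> p)
    then show ?case
      using neg_ln_upper_tail_prob_broom_smallo(1)[of _ \<epsilon> p] by (auto simp: max_density_broom)
  next
    case (3 H \<epsilon> p)
    then show ?case
      using neg_ln_upper_tail_prob_broom_smallo(2)[of _ \<epsilon> p] by (auto simp: max_density_broom)
  qed simp
qed

end
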